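(* Let $q$ be a positive integer and let $\mathcal{H}$ be a $q$-uniform (possibly infinite) hypergraph that satisfies the fractional Helly property. If $\mathcal{H}$ has arbitrarily large finite independent sets (that is, for every $n\in\mathbb{N}$ there is a finite independent set of $\mathcal{H}$ of size at least $n$), then $\mathcal{H}$ has an infinite independent set.
   Context: A $q$-uniform hypergraph $\mathcal{H}$ consists of a (possibly infinite) vertex set $V(\mathcal{H})$ and a collection of $q$-element subsets of $V(\mathcal{H})$, called edges. For $S\subset V(\mathcal{H})$, $\mathcal{H}[S]$ is the subhypergraph consisting of the edges contained in $S$, and $e(\cdot)$ denotes the number of edges. A set of vertices is independent if it contains no edge. A set of vertices is a ($q$-uniform) clique if all of its $q$-element subsets are edges. $\mathcal{H}$ satisfies the fractional Helly property if for every $\alpha>0$ there exists $\beta>0$ such that, for every finite $S\subset V(\mathcal{H})$ with $e(\mathcal{H}[S])\ge \alpha\binom{|S|}{q}$, there exists a clique of $\mathcal{H}[S]$ of size at least $\beta|S|$. *)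

theory Defs
  imports Complex_Main "HOL-Library.Ramsey"
begin

record 'a hypergraph =
  verts :: "'a set"
  hyperedges :: "'a set set"

definition uniform_hypergraph :: "nat \<Rightarrow> 'a hypergraph \<Rightarrow> bool" where
  "uniform_hypergraph q H \<longleftrightarrow> hyperedges H \<subseteq> nsets (verts H) q"

definition induced :: "'a hypergraph \<Rightarrow> 'a set \<Rightarrow> 'a hypergraph" where
  "induced H S = \<lparr>verts = S, hyperedges = {e \<in> hyperedges H. e \<subseteq> S}\<rparr>"

definition independent_set :: "'a hypergraph \<Rightarrow> 'a set \<Rightarrow> bool" where
  "independent_set H I \<longleftrightarrow> I \<subseteq> verts H \<and> (\<forall>e \<in> hyperedges H. \<not> e \<subseteq> I)"

(* A set with fewer than q elements is vacuously a clique. *)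
definition hyperclique :: "nat \<Rightarrow> 'a hypergraph \<Rightarrow> 'a set \<Rightarrow> bool" where
  "hyperclique q H C \<longleftrightarrow> C \<subseteq> verts H \<and> nsets C q \<subseteq> hyperedges H"

definition fractional_Helly :: "nat \<Rightarrow> 'a hypergraph \<Rightarrow> bool" where
  "fractional_Helly q H \<longleftrightarrow>
    (\<forall>\<alpha>::real. \<alpha> > 0 \<longrightarrow> (\<exists>\<beta>::real. \<beta> > 0 \<and>
      (\<forall>S. S \<subseteq> verts H \<and> finite S \<and>
           real (card (hyperedges (induced H S))) \<ge> \<alpha> * real (card S choose q) \<longrightarrow>
         (\<exists>C. hyperclique q (induced H S) C \<and> real (card C) \<ge> \<beta> * real (card S)))))"

end

theory Submission
  imports Defs
begin

text \<open>
  Call a vertex set rich if it contains arbitrarily large finite independent sets. Richness is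
  partition regular, so there is an ultrafilter of rich sets; it is free, as finite sets are not
  rich. Iterating the quantifier \<open>for almost all vertices\<close> over this ultrafilter \<open>q\<close> times decides
  whether the generic \<open>q\<close>-tuple is an edge. If it is not, a greedy choice of generic vertices
  yields an infinite independent set. If it is, choosing generic independent sets instead of
  generic vertices yields complete \<open>q\<close>-partite subhypergraphs whose parts are independent and
  have any prescribed size \<open>n\<close>. Such a subhypergraph has edge density bounded below, but its
  cliques have at most \<open>q - 1\<close> vertices in each part, against the fractional Helly property.
\<close>

text \<open>Zorn's lemma is applied to sets of filters containing \<open>F\<close> with proper
  infimum, ordered by inclusion, so that unions bound chains. If the infimum of a union were
  improper, that of finitely many of its members would be too, and these all lie in one set of the
  chain.\<close>

lemma ultrafilter_exists:
  fixes F :: "'a filter"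
  assumes "F \<noteq> bot"
  obtains U where "U \<le> F" "U \<noteq> bot"
    "\<And>P. \<not> eventually P U \<Longrightarrow> eventually (\<lambda>x. \<not> P x) U"
proof -
  let ?A = "{S :: 'a filter set. F \<in> S \<and> Inf S \<noteq> bot}"
  have "{F} \<in> ?A"
    using assms by simp
  then have "?A \<noteq> {}" by blast
  moreover have "\<Union>C \<in> ?A" if "C \<noteq> {}" and C: "subset.chain ?A C" for C
  proof -
    have CA: "C \<subseteq> ?A" using C by (auto simp: subset_chain_def)
    have "F \<in> \<Union>C" using that(1) CA by blast
    moreover have "Inf (\<Union>C) \<noteq> bot"
    proof
      assume "Inf (\<Union>C) = bot"
      then obtain X where X: "X \<subseteq> \<Union>C" "finite X" "eventually (\<lambda>_. False) (Inf X)"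
        by (metis eventually_Inf trivial_limit_def)
      obtain B where "B \<in> C" "X \<subseteq> B"
        using finite_subset_Union_chain[OF X(2,1) \<open>C \<noteq> {}\<close> C] .
      then have "Inf B = bot"
        using X(2,3) by (metis eventually_Inf trivial_limit_def)
      with \<open>B \<in> C\<close> CA show False by auto
    qed
    ultimately show ?thesis by simp
  qed
  ultimately obtain M where M: "M \<in> ?A" and max: "\<forall>X\<in>?A. M \<subseteq> X \<longrightarrow> X = M"
    by (metis (lifting) subset_Zorn_nonempty)
  have "eventually (\<lambda>x. \<not> P x) (Inf M)" if P: "\<not> eventually P (Inf M)" for P
  proof -
    \<comment> \<open>Adjoining this principal filter would make the infimum improper only if
      \<open>P\<close> held eventually, so maximality puts it in \<open>M\<close> already.\<close>
    let ?N = "insert (principal {x. \<not> P x}) M"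
    have "Inf ?N \<noteq> bot"
      using P by (simp add: trivial_limit_def inf.commute[of "principal _"]
          eventually_inf_principal)
    then have "principal {x. \<not> P x} \<in> M"
      using M max by blast
    then have "Inf M \<le> principal {x. \<not> P x}"
      by (rule Inf_lower)
    then show ?thesis
      by (simp add: le_principal)
  qed
  moreover have "Inf M \<le> F" "Inf M \<noteq> bot"
    using M by (auto intro: Inf_lower)
  ultimately show thesis
    using that by blast
qed

definition rich :: "'a hypergraph \<Rightarrow> 'a set \<Rightarrow> bool" where
  "rich H X \<longleftrightarrow> (\<forall>n. \<exists>I \<subseteq> X. finite I \<and> independent_set H I \<and> n \<le> card I)"

lemma independent_set_subset: "independent_set H I \<Longrightarrow> J \<subseteq> I \<Longrightarrow> independent_set H J"
  unfolding independent_set_def by blast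

lemma rich_mono: "rich H X \<Longrightarrow> X \<subseteq> Y \<Longrightarrow> rich H Y"
  unfolding rich_def by (meson subset_trans)

lemma rich_infinite:
  assumes "rich H X" shows "infinite X"
proof
  assume "finite X"
  obtain I where "I \<subseteq> X" "Suc (card X) \<le> card I"
    using assms unfolding rich_def by blast
  with card_mono[OF \<open>finite X\<close> \<open>I \<subseteq> X\<close>] show False by simp
qed

lemma rich_obtains:
  assumes "rich H X"
  obtains I where "I \<subseteq> X" "finite I" "independent_set H I" "card I = n"
proof -
  obtain J where J: "J \<subseteq> X" "finite J" "independent_set H J" "n \<le> card J"
    using assms unfolding rich_def by blast
  obtain I where "I \<subseteq> J" "card I = n" "finite I"
    using obtain_subset_with_card_n[OF J(4)] by blast
  then show thesis
    using that J independent_set_subset[OF J(3)] by blast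
qed

text \<open>If independent sets have fewer than \<open>m\<close> points in \<open>X\<close> and
  fewer than \<open>n\<close> in \<open>Y\<close>, then one of size \<open>m + n\<close> in the
  union is impossible, since its traces on \<open>X\<close> and \<open>Y\<close> are
  independent.\<close>

lemma rich_Un:
  assumes "rich H (X \<union> Y)" shows "rich H X \<or> rich H Y"
proof (rule ccontr)
  assume "\<not> ?thesis"
  then obtain m n where
    m: "\<And>I. I \<subseteq> X \<Longrightarrow> finite I \<Longrightarrow> independent_set H I \<Longrightarrow> card I < m" and
    n: "\<And>I. I \<subseteq> Y \<Longrightarrow> finite I \<Longrightarrow> independent_set H I \<Longrightarrow> card I < n"
    unfolding rich_def by (meson not_le)
  obtain I where I: "I \<subseteq> X \<union> Y" "finite I" "independent_set H I" "card I = m + n"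
    using rich_obtains[OF assms] .
  have "card (I \<inter> X) < m" "card (I \<inter> Y) < n"
    using m[of "I \<inter> X"] n[of "I \<inter> Y"] I independent_set_subset[OF I(3)] by auto
  moreover have "card I \<le> card (I \<inter> X) + card (I \<inter> Y)"
    using card_Un_le[of "I \<inter> X" "I \<inter> Y"] I(1) by (simp add: Int_Un_distrib[symmetric] Int_absorb2)
  ultimately show False using I(4) by simp
qed

text \<open>By partition regularity the sets whose complement in \<open>V\<close> is not rich form a
  filter. In an ultrafilter refining it every set meets \<open>V\<close> in a rich set, as otherwise
  its complement would belong to the ultrafilter too.\<close>

lemma rich_ultrafilter:
  assumes "rich H V"
  obtains U where "U \<noteq> bot" "\<And>P. \<not> eventually P U \<Longrightarrow> eventually (\<lambda>x. \<not> P x) U"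
    "\<And>P. eventually P U \<Longrightarrow> rich H {x \<in> V. P x}"
proof -
  define F where "F = Abs_filter (\<lambda>P. \<not> rich H {x \<in> V. \<not> P x})"
  have "is_filter (\<lambda>P. \<not> rich H {x \<in> V. \<not> P x})"
  proof
    show "\<not> rich H {x \<in> V. \<not> True}"
      using rich_infinite by fastforce
  next
    fix P Q assume PQ: "\<not> rich H {x \<in> V. \<not> P x}" "\<not> rich H {x \<in> V. \<not> Q x}"
    have "{x \<in> V. \<not> (P x \<and> Q x)} = {x \<in> V. \<not> P x} \<union> {x \<in> V. \<not> Q x}" by blast
    with PQ rich_Un[of H "{x \<in> V. \<not> P x}" "{x \<in> V. \<not> Q x}"]
    show "\<not> rich H {x \<in> V. \<not> (P x \<and> Q x)}" by metis
  next
    fix P Q :: "'a \<Rightarrow> bool" assume "\<forall>x. P x \<longrightarrow> Q x" "\<not> rich H {x \<in> V. \<not> P x}"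
    then show "\<not> rich H {x \<in> V. \<not> Q x}"
      using rich_mono[of H "{x \<in> V. \<not> Q x}" "{x \<in> V. \<not> P x}"] by blast
  qed
  then have ev: "eventually P F \<longleftrightarrow> \<not> rich H {x \<in> V. \<not> P x}" for P
    unfolding F_def by (rule eventually_Abs_filter)
  have "F \<noteq> bot"
    using assms by (simp add: trivial_limit_def ev)
  then obtain U where U: "U \<le> F" "U \<noteq> bot" "\<And>P. \<not> eventually P U \<Longrightarrow> eventually (\<lambda>x. \<not> P x) U"
    by (rule ultrafilter_exists) blast
  have "rich H {x \<in> V. P x}" if "eventually P U" for P
  proof (rule ccontr)
    assume "\<not> ?thesis"
    then have "eventually (\<lambda>x. \<not> P x) U"
      using U(1) by (simp add: filter_leD ev)
    with that have "eventually (\<lambda>x. False) U"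
      by (rule eventually_elim2) simp
    with U(2) show False by (simp add: trivial_limit_def)
  qed
  with U that show thesis by blast
qed

text \<open>This is \<open>k\<close> nested quantifiers "for almost all \<open>a\<close>", with
  \<open>X\<close> collecting the vertices chosen so far. Recording them as a set forgets the order
  of choice.\<close>

fun generic :: "'a filter \<Rightarrow> ('a set \<Rightarrow> bool) \<Rightarrow> nat \<Rightarrow> 'a set \<Rightarrow> bool" where
  "generic U P 0 X \<longleftrightarrow> P X"
| "generic U P (Suc k) X \<longleftrightarrow> eventually (\<lambda>a. generic U P k (insert a X)) U"

text \<open>An ultrafilter quantifier commutes with negation, so negation moves inward through all
  \<open>k\<close> of them.\<close>

lemma generic_not:
  assumes "\<And>P. \<not> eventually P U \<Longrightarrow> eventually (\<lambda>x. \<not> P x) U"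
  shows "\<not> generic U P k X \<Longrightarrow> generic U (\<lambda>X. \<not> P X) k X"
proof (induction k arbitrary: X)
  case (Suc k)
  then have "eventually (\<lambda>a. \<not> generic U P k (insert a X)) U"
    using assms by simp
  then show ?case
    by (simp, rule eventually_mono) (rule Suc.IH)
qed simp

lemma generic_homogeneous_set:
  assumes "U \<noteq> bot" and "eventually (\<lambda>x. x \<in> V) U" and free: "\<And>a. eventually (\<lambda>x. x \<noteq> a) U"
    and "generic U P q {}"
  obtains I where "infinite I" "I \<subseteq> V" "\<And>X. X \<in> nsets I q \<Longrightarrow> P X"
proof -
  \<comment> \<open>The invariant of the greedy choice, which is carried out by Zorn's lemma.
    Subsets with fewer than \<open>q\<close> points keep further extension possible; for those with
    exactly \<open>q\<close> points no quantifier is left and \<open>P\<close> itself holds.\<close>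
  let ?good = "\<lambda>I. \<forall>X\<subseteq>I. finite X \<longrightarrow> card X \<le> q \<longrightarrow> generic U P (q - card X) X"
  let ?A = "{I. I \<subseteq> V \<and> ?good I}"
  have "{} \<in> ?A" using assms(4) by simp
  then have "?A \<noteq> {}" by blast
  moreover have "\<Union>C \<in> ?A" if "C \<noteq> {}" and C: "subset.chain ?A C" for C
  proof -
    have CA: "C \<subseteq> ?A" using C by (auto simp: subset_chain_def)
    have "generic U P (q - card X) X" if X: "X \<subseteq> \<Union>C" "finite X" "card X \<le> q" for X
    proof -
      obtain B where "B \<in> C" "X \<subseteq> B"
        using finite_subset_Union_chain[OF X(2,1) \<open>C \<noteq> {}\<close> C] .
      with CA X show ?thesis by auto
    qed
    moreover have "\<Union>C \<subseteq> V" using CA by auto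
    ultimately show ?thesis by simp
  qed
  ultimately obtain M where M: "M \<subseteq> V" "?good M" and max: "\<forall>I\<in>?A. M \<subseteq> I \<longrightarrow> I = M"
    using subset_Zorn_nonempty[of ?A] by auto
  have "infinite M"
  proof
    assume fin: "finite M"
    \<comment> \<open>A finite \<open>M\<close> imposes only finitely many conditions on a new
      vertex, each true almost everywhere, so some vertex outside \<open>M\<close> meets them all
      and contradicts maximality.\<close>
    let ?X = "{X. X \<subseteq> M \<and> card X < q}"
    have "eventually (\<lambda>a. \<forall>X\<in>?X. generic U P (q - Suc (card X)) (insert a X)) U"
    proof (intro eventually_ball_finite ballI)
      fix X assume X: "X \<in> ?X"
      then have "generic U P (Suc (q - Suc (card X))) X"
        using M(2) fin by (auto simp: Suc_diff_Suc dest: finite_subset)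
      then show "eventually (\<lambda>a. generic U P (q - Suc (card X)) (insert a X)) U" by simp
    qed (use fin in simp)
    moreover have "eventually (\<lambda>a. \<forall>x\<in>M. a \<noteq> x) U"
      using fin free by (intro eventually_ball_finite) auto
    ultimately have "eventually (\<lambda>a. a \<in> V \<and> a \<notin> M \<and>
        (\<forall>X\<in>?X. generic U P (q - Suc (card X)) (insert a X))) U"
      using assms(2) by eventually_elim blast
    then obtain a where a: "a \<in> V" "a \<notin> M"
      and step: "\<And>X. X \<subseteq> M \<Longrightarrow> card X < q \<Longrightarrow> generic U P (q - Suc (card X)) (insert a X)"
      using eventually_happens'[OF assms(1)] by blast
    have "generic U P (q - card X) X" if X: "X \<subseteq> insert a M" "finite X" "card X \<le> q" for X
    proof (cases "a \<in> X")
      case True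
      then have "card X = Suc (card (X - {a}))"
        using X(2) by (metis card_Suc_Diff1)
      moreover have "X - {a} \<subseteq> M" using X(1) by blast
      ultimately show ?thesis
        using step[of "X - {a}"] X(3) True by (simp add: insert_absorb)
    next
      case False
      then show ?thesis using M(2) X by blast
    qed
    with a M(1) max have "insert a M = M" by blast
    with a show False by blast
  qed
  moreover have "P X" if "X \<in> nsets M q" for X
  proof -
    have "X \<subseteq> M" "finite X" "card X = q"
      using that by (auto simp: nsets_def)
    with M(2)[rule_format, of X] show ?thesis by simp
  qed
  ultimately show thesis using that M(1) by blast
qed

text \<open>
  The set \<open>S\<close> is a disjoint union of \<open>m\<close> independent sets of size \<open>n\<close>, and \<open>T\<close> is the set of its
  transversals.
\<close>

lemma generic_transversals:
  assumes "q > 0" and rich: "\<And>P. eventually P U \<Longrightarrow> rich H {x \<in> verts H. P x}"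
    and free: "\<And>a. eventually (\<lambda>x. x \<noteq> a) U"
    and "generic U P q {}" and "m \<le> q"
  shows "\<exists>S T. S \<subseteq> verts H \<and> finite S \<and> card S = m * n \<and> T \<subseteq> Pow S \<and> card T = n ^ m \<and>
    (\<forall>X\<in>T. generic U P (q - m) X) \<and>
    (\<forall>C\<subseteq>S. nsets C q \<subseteq> hyperedges H \<longrightarrow> card C \<le> m * (q - 1))"
  using \<open>m \<le> q\<close>
proof (induction m)
  case 0
  show ?case
    by (rule exI[of _ "{}"], rule exI[of _ "{{}}"]) (use assms(4) in simp)
next
  case (Suc m)
  then obtain S T where S: "S \<subseteq> verts H" "finite S" "card S = m * n"
    and T: "T \<subseteq> Pow S" "card T = n ^ m" "\<And>X. X \<in> T \<Longrightarrow> generic U P (q - m) X"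
    and clique: "\<And>C. C \<subseteq> S \<Longrightarrow> nsets C q \<subseteq> hyperedges H \<Longrightarrow> card C \<le> m * (q - 1)"
    by (auto dest: Suc_leD)
  have finT: "finite T"
    using T(1) S(2) by (meson finite_Pow_iff finite_subset)
  have qm: "q - m = Suc (q - Suc m)"
    using Suc.prems by simp
  \<comment> \<open>Almost every vertex extends all of the finitely many partial transversals at
    once. The vertices outside \<open>S\<close> that do so form a rich set, which supplies the next
    part \<open>A\<close>.\<close>
  have "eventually (\<lambda>a. \<forall>X\<in>T. generic U P (q - Suc m) (insert a X)) U"
    using finT T(3) unfolding qm by (intro eventually_ball_finite) auto
  moreover have "eventually (\<lambda>a. \<forall>x\<in>S. a \<noteq> x) U"
    using S(2) free by (intro eventually_ball_finite) auto
  ultimately have "eventually (\<lambda>a. a \<notin> S \<and> (\<forall>X\<in>T. generic U P (q - Suc m) (insert a X))) U"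
    by eventually_elim blast
  from rich[OF this]
  obtain A where A': "A \<subseteq> {a \<in> verts H. a \<notin> S \<and> (\<forall>X\<in>T. generic U P (q - Suc m) (insert a X))}"
    "finite A" "independent_set H A" "card A = n"
    by (rule rich_obtains)
  then have A: "A \<subseteq> verts H" "A \<inter> S = {}" "finite A" "independent_set H A" "card A = n"
    and step: "\<And>a X. a \<in> A \<Longrightarrow> X \<in> T \<Longrightarrow> generic U P (q - Suc m) (insert a X)"
    by auto
  let ?T = "(\<lambda>(a, X). insert a X) ` (A \<times> T)"
  \<comment> \<open>Since \<open>A\<close> misses \<open>S\<close>, both \<open>X\<close> and
    \<open>a\<close> can be read off from \<open>insert a X\<close>.\<close>
  have "inj_on (\<lambda>(a, X). insert a X) (A \<times> T)"
  proof (intro inj_onI, clarsimp)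
    fix a X b Y assume *: "a \<in> A" "X \<in> T" "b \<in> A" "Y \<in> T" "insert a X = insert b Y"
    have "insert a X \<inter> S = X" "insert b Y \<inter> S = Y" "insert a X - S = {a}" "insert b Y - S = {b}"
      using * T(1) A(2) by auto
    with *(5) show "a = b \<and> X = Y" by (metis singleton_inject)
  qed
  then have "card ?T = n ^ Suc m"
    by (simp add: card_image card_cartesian_product A(5) T(2))
  moreover have "card C \<le> Suc m * (q - 1)"
    if C: "C \<subseteq> S \<union> A" "nsets C q \<subseteq> hyperedges H" for C
  proof -
    have "card (C \<inter> S) \<le> m * (q - 1)"
      using C(2) nsets_mono[of "C \<inter> S" C q] by (intro clique) auto
    \<comment> \<open>Any \<open>q\<close> vertices of the clique in \<open>A\<close> would form an
      edge inside an independent set.\<close>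
    moreover have "card (C \<inter> A) \<le> q - 1"
    proof (rule ccontr)
      assume "\<not> ?thesis"
      then have "q \<le> card (C \<inter> A)" by simp
      then obtain X where "X \<subseteq> C \<inter> A" "card X = q" "finite X"
        by (rule obtain_subset_with_card_n)
      with C(2) A(4) show False
        by (auto simp: nsets_def independent_set_def)
    qed
    moreover have "card C \<le> card (C \<inter> S) + card (C \<inter> A)"
      using card_Un_le[of "C \<inter> S" "C \<inter> A"] C(1) by (simp add: Int_Un_distrib[symmetric] Int_absorb2)
    ultimately show ?thesis by simp
  qed
  moreover have "card (S \<union> A) = Suc m * n"
    using S A by (subst card_Un_disjoint) auto
  moreover have "?T \<subseteq> Pow (S \<union> A)" using T(1) by auto
  moreover have "\<forall>X\<in>?T. generic U P (q - Suc m) X" using step by auto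
  ultimately show ?case
    using S(1,2) A(1,3) by (intro exI[of _ "S \<union> A"] exI[of _ ?T]) auto
qed

theorem theorem4:
  fixes q :: nat and H :: "'a hypergraph"
  assumes "q > 0"
    and "uniform_hypergraph q H"
    and "fractional_Helly q H"
    and "\<forall>n::nat. \<exists>I. finite I \<and> independent_set H I \<and> card I \<ge> n"
  shows "\<exists>I. infinite I \<and> independent_set H I"
proof -
  let ?E = "\<lambda>X. X \<in> hyperedges H"
  have "rich H (verts H)"
    using assms(4) by (metis independent_set_def rich_def)
  then obtain U where U: "U \<noteq> bot" "\<And>P. \<not> eventually P U \<Longrightarrow> eventually (\<lambda>x. \<not> P x) U"
    and rich: "\<And>P. eventually P U \<Longrightarrow> rich H {x \<in> verts H. P x}"
    by (rule rich_ultrafilter) (rule that; assumption)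
  have "\<not> rich H {}"
    using rich_infinite by blast
  then have V: "eventually (\<lambda>x. x \<in> verts H) U"
    using U(2)[of "\<lambda>x. x \<in> verts H"] rich[of "\<lambda>x. x \<notin> verts H"] by auto
  \<comment> \<open>Otherwise a subset of a singleton would be rich, hence infinite.\<close>
  have free: "eventually (\<lambda>x. x \<noteq> a) U" for a
  proof (rule ccontr)
    assume "\<not> ?thesis"
    then have "infinite {x \<in> verts H. \<not> x \<noteq> a}"
      by (intro rich_infinite[of H] rich U(2))
    moreover have "{x \<in> verts H. \<not> x \<noteq> a} \<subseteq> {a}" by blast
    ultimately show False using finite_subset by blast
  qed
  show ?thesis
  proof (cases "generic U ?E q {}")
    case False
    then have "generic U (\<lambda>X. \<not> ?E X) q {}"
      by (rule generic_not[rotated]) (rule U(2))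
    then obtain I where "infinite I" "I \<subseteq> verts H" "\<And>X. X \<in> nsets I q \<Longrightarrow> \<not> ?E X"
      by (rule generic_homogeneous_set[OF U(1) V free]) blast
    with assms(2) have "independent_set H I"
      by (auto simp: independent_set_def uniform_hypergraph_def nsets_def)
    with \<open>infinite I\<close> show ?thesis by blast
  next
    case True
    \<comment> \<open>The set \<open>S\<close> below has \<open>q * n\<close> vertices and spans at
      least \<open>n ^ q\<close> edges, while \<open>(q * n) choose q\<close> is at most
      \<open>(q * n) ^ q\<close>. This bounds the density from below independently of
      \<open>n\<close>.\<close>
    define \<alpha> :: real where "\<alpha> = 1 / real q ^ q"
    have "\<alpha> > 0" using assms(1) by (simp add: \<alpha>_def)
    with assms(3) obtain \<beta> :: real where "\<beta> > 0" and \<beta>: "\<And>S. S \<subseteq> verts H \<Longrightarrow> finite S \<Longrightarrow>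
        \<alpha> * real (card S choose q) \<le> real (card (hyperedges (induced H S))) \<Longrightarrow>
        \<exists>C. hyperclique q (induced H S) C \<and> \<beta> * real (card S) \<le> real (card C)"
      unfolding fractional_Helly_def by auto
    \<comment> \<open>With this part size the Helly clique has at least \<beta> times
      \<open>q * n\<close>, so more than \<open>q * q\<close>, vertices, whereas cliques in
      \<open>S\<close> have at most \<open>q * (q - 1)\<close>.\<close>
    obtain n where n: "real q < \<beta> * real n"
      using reals_Archimedean3[OF \<open>\<beta> > 0\<close>] by (metis mult.commute)
    obtain S T where S: "S \<subseteq> verts H" "finite S" "card S = q * n"
      and T: "T \<subseteq> Pow S" "card T = n ^ q" "\<And>X. X \<in> T \<Longrightarrow> ?E X"
      and clique: "\<And>C. C \<subseteq> S \<Longrightarrow> nsets C q \<subseteq> hyperedges H \<Longrightarrow> card C \<le> q * (q - 1)"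
      using generic_transversals[OF assms(1) rich free True order_refl, of n] by auto
    have "n ^ q \<le> card (hyperedges (induced H S))"
      unfolding T(2)[symmetric]
    proof (rule card_mono)
      have "hyperedges (induced H S) \<subseteq> Pow S" by (auto simp: induced_def)
      then show "finite (hyperedges (induced H S))"
        using S(2) by (meson finite_Pow_iff finite_subset)
      show "T \<subseteq> hyperedges (induced H S)"
        using T(1,3) by (auto simp: induced_def)
    qed
    moreover have "\<alpha> * real (card S choose q) \<le> real (n ^ q)"
    proof -
      have "card S choose q \<le> (q * n) ^ q"
      proof (cases "q \<le> card S")
        case True
        then show ?thesis using binomial_le_pow[OF True] S(3) by simp
      next
        case False
        then show ?thesis by (simp add: binomial_eq_0)
      qed
      then have "real (card S choose q) \<le> real q ^ q * real n ^ q"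
        by (metis of_nat_le_iff of_nat_mult of_nat_power power_mult_distrib)
      then show ?thesis
        using assms(1) by (simp add: \<alpha>_def divide_le_eq mult.commute)
    qed
    ultimately have "\<alpha> * real (card S choose q) \<le> real (card (hyperedges (induced H S)))"
      by linarith
    then obtain C where C: "hyperclique q (induced H S) C" "\<beta> * real (card S) \<le> real (card C)"
      using \<beta>[OF S(1,2)] by blast
    have "card C \<le> q * (q - 1)"
      using C(1) by (intro clique) (auto simp: hyperclique_def induced_def)
    also have "\<dots> \<le> q * q" by simp
    finally have "\<beta> * real (card S) \<le> real q * real q"
      using C(2) by (metis of_nat_le_iff of_nat_mult order_trans)
    moreover have "real q * real q < real q * (\<beta> * real n)"
      using n assms(1) by simp
    ultimately show ?thesis
      using S(3) by (simp add: algebra_simps)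
  qed
qed

end
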